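(* Let $G$ be a finite graph with vertex set $X$, and let $S=\operatorname{span}\{|x\rangle\langle x'| : x=x'\text{ or }x\sim x'\}\subseteq\mathcal{L}(\mathbb{C}X)$ be the associated non-commutative graph. Then $$\widetilde{\vartheta}(S)=\vartheta(S)=\vartheta(G),$$ where $\vartheta(G)$ is the Lovász number of $G$.
   Context: Graphs are simple and undirected; $x\sim x'$ means $x,x'$ are joined by an edge. $\mathbb{C}X$ is the Hilbert space with orthonormal basis $\{|x\rangle\}_{x\in X}$, and $\mathcal{L}(A)$ is the space of linear operators on $A$. The Lovász number is $\vartheta(G)=\max\{\|\mathbf{1}+T\|: T_{xx'}=0\text{ if }x=x'\text{ or }x\sim x',\ \mathbf{1}+T\ge0\}$, the maximum being over Hermitian complex $|X|\times|X|$ matrices $T$ (equivalently, the usual Lovász theta function bounding the independence number of $G$ from above). A non-commutative graph is a linear subspace $S\subseteq\mathcal{L}(A)$, $A$ a finite-dimensional complex Hilbert space, with $\mathbf{1}\in S$ and $S=S^\dagger$. $S^\perp$ is the orthogonal complement with respect to the Hilbert-Schmidt inner product $\operatorname{Tr}X^\dagger Y$, and $\|\cdot\|$ is the operator norm. Define $\vartheta(S):=\max\{\|\mathbf{1}+T\|: T\in S^\perp,\ \mathbf{1}+T\ge 0\}$ and the quantum Lovász function $$\widetilde{\vartheta}(S):=\sup_{n\in\mathbb{N}}\vartheta\bigl(S\otimes\mathcal{L}(\mathbb{C}^n)\bigr)=\sup_n\max\{\|\mathbf{1}+T\|: T\in S^\perp\otimes\mathcal{L}(\mathbb{C}^n),\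 \mathbf{1}+T\ge 0\}.$$ *)

theory Defs
  imports "HOL-Analysis.Analysis" "HOL-Library.Function_Algebras" "Graph_Theory.Graph_Theory"
begin

text \<open>
  For a finite index set \<open>I\<close>, the Hilbert space with orthonormal basis \<open>(|i\<rangle>)\<close>, \<open>i \<in> I\<close>, is
  represented by the coefficient functions vanishing outside \<open>I\<close>, and an operator by its matrix
  \<open>T i j = \<langle>i|T|j\<rangle>\<close>, vanishing outside \<open>I \<times> I\<close>.  Working with index sets rather than index types
  lets the dimension \<open>n\<close> of the auxiliary space vary inside a formula.
  Matrices are added pointwise (theory Function_Algebras); beware that the constant \<open>1\<close> of that
  theory is the all-one matrix, so the identity operator is written \<open>id_op I\<close>.
\<close>

type_synonym 'i cvec = "'i \<Rightarrow> complex"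
type_synonym 'i op = "'i \<Rightarrow> 'i \<Rightarrow> complex"

definition hilb :: "'i set \<Rightarrow> 'i cvec set" where
  "hilb I = {v. \<forall>i. i \<notin> I \<longrightarrow> v i = 0}"

definition lin_ops :: "'i set \<Rightarrow> 'i op set" where
  "lin_ops I = {T. \<forall>i j. i \<notin> I \<or> j \<notin> I \<longrightarrow> T i j = 0}"

definition id_op :: "'i set \<Rightarrow> 'i op" where
  "id_op I = (\<lambda>i j. if i \<in> I \<and> i = j then 1 else 0)"

definition ketbra :: "'i \<Rightarrow> 'i \<Rightarrow> 'i op" where
  "ketbra x y = (\<lambda>i j. if i = x \<and> j = y then 1 else 0)"

definition scale_op :: "complex \<Rightarrow> 'i op \<Rightarrow> 'i op" where
  "scale_op c T = (\<lambda>i j. c * T i j)"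

definition adj_op :: "'i op \<Rightarrow> 'i op" where
  "adj_op T = (\<lambda>i j. cnj (T j i))"

definition comp_op :: "'i set \<Rightarrow> 'i op \<Rightarrow> 'i op \<Rightarrow> 'i op" where
  "comp_op I A B = (\<lambda>i j. \<Sum>k\<in>I. A i k * B k j)"

definition trace_op :: "'i set \<Rightarrow> 'i op \<Rightarrow> complex" where
  "trace_op I A = (\<Sum>i\<in>I. A i i)"

definition apply_op :: "'i set \<Rightarrow> 'i op \<Rightarrow> 'i cvec \<Rightarrow> 'i cvec" where
  "apply_op I A v = (\<lambda>i. \<Sum>j\<in>I. A i j * v j)"

definition inner_vec :: "'i set \<Rightarrow> 'i cvec \<Rightarrow> 'i cvec \<Rightarrow> complex" where
  "inner_vec I v w = (\<Sum>i\<in>I. cnj (v i) * w i)"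

definition norm_vec :: "'i set \<Rightarrow> 'i cvec \<Rightarrow> real" where
  "norm_vec I v = L2_set (\<lambda>i. cmod (v i)) I"

definition op_norm :: "'i set \<Rightarrow> 'i op \<Rightarrow> real" where
  "op_norm I A = (SUP v\<in>{v \<in> hilb I. norm_vec I v \<le> 1}. norm_vec I (apply_op I A v))"

text \<open>The order on \<^typ>\<open>complex\<close> makes \<open>0 \<le> z\<close> mean that \<open>z\<close> is real and nonnegative, so the
  following implies that \<open>A\<close> is Hermitian.\<close>

definition psd :: "'i set \<Rightarrow> 'i op \<Rightarrow> bool" where
  "psd I A \<longleftrightarrow> (\<forall>v\<in>hilb I. 0 \<le> inner_vec I v (apply_op I A v))"

global_interpretation op: vector_space scale_op
  by unfold_locales (auto simp: scale_op_def fun_eq_iff algebra_simps)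

definition nc_graph :: "'i set \<Rightarrow> 'i op set \<Rightarrow> bool" where
  "nc_graph I S \<longleftrightarrow> finite I \<and> S \<subseteq> lin_ops I \<and> op.subspace S \<and> id_op I \<in> S \<and> adj_op ` S = S"

definition hs_perp :: "'i set \<Rightarrow> 'i op set \<Rightarrow> 'i op set" where
  "hs_perp I S = {T \<in> lin_ops I. \<forall>X\<in>S. trace_op I (comp_op I (adj_op X) T) = 0}"

text \<open>Maxima are rendered by \<^const>\<open>Greatest\<close>, which denotes an element of the set that is an
  upper bound of it.\<close>

definition theta :: "'i set \<Rightarrow> 'i op set \<Rightarrow> real" where
  "theta I S = (GREATEST r. \<exists>T. T \<in> hs_perp I S \<and> psd I (id_op I + T) \<and> r = op_norm I (id_op I + T))"

text \<open>The tensor product of spaces of operators on the spaces with index sets \<open>I\<close> and \<open>J\<close>; the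
  tensor product of these spaces has index set \<open>I \<times> J\<close>.\<close>

definition kron :: "'i op \<Rightarrow> 'j op \<Rightarrow> ('i \<times> 'j) op" where
  "kron A B = (\<lambda>(i, k) (j, l). A i j * B k l)"

definition tensor_ops :: "'i op set \<Rightarrow> 'j op set \<Rightarrow> ('i \<times> 'j) op set" where
  "tensor_ops S R = op.span {kron A B | A B. A \<in> S \<and> B \<in> R}"

text \<open>The supremum is taken in \<^typ>\<open>ereal\<close>, so that its value is meaningful without a boundedness
  argument.\<close>

definition quantum_theta :: "'i set \<Rightarrow> 'i op set \<Rightarrow> ereal" where
  "quantum_theta I S =
    (SUP n\<in>{1::nat..}. ereal (theta (I \<times> {..<n}) (tensor_ops S (lin_ops {..<n}))))"

text \<open>A finite simple undirected graph is a \<^const>\<open>pair_graph\<close>: its arc relation \<^const>\<open>parcs\<close> is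
  symmetric and irreflexive, and \<open>x\<close>, \<open>x'\<close> are joined by an edge iff \<open>(x, x') \<in> parcs G\<close>.\<close>

definition graph_space :: "'x pair_pre_digraph \<Rightarrow> 'x op set" where
  "graph_space G = op.span {ketbra x x' | x x'.
     x \<in> pverts G \<and> x' \<in> pverts G \<and> (x = x' \<or> (x, x') \<in> parcs G)}"

definition lovasz_number :: "'x pair_pre_digraph \<Rightarrow> real" where
  "lovasz_number G = (GREATEST r. \<exists>T\<in>lin_ops (pverts G).
     adj_op T = T \<and>
     (\<forall>x\<in>pverts G. \<forall>x'\<in>pverts G. x = x' \<or> (x, x') \<in> parcs G \<longrightarrow> T x x' = 0) \<and>
     psd (pverts G) (id_op (pverts G) + T) \<and>
     r = op_norm (pverts G) (id_op (pverts G) + T))"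

lemma adj_adj [simp]: "adj_op (adj_op T) = T"
  by (simp add: adj_op_def)

lemma adj_zero: "adj_op 0 = 0"
  by (simp add: adj_op_def fun_eq_iff)

lemma adj_add: "adj_op (A + B) = adj_op A + adj_op B"
  by (simp add: adj_op_def fun_eq_iff)

lemma adj_scale: "adj_op (scale_op c A) = scale_op (cnj c) (adj_op A)"
  by (simp add: adj_op_def scale_op_def fun_eq_iff)

lemma subspace_lin_ops: "op.subspace (lin_ops I)"
  by (auto simp: op.subspace_def lin_ops_def scale_op_def)

lemma nc_graph_span:
  assumes "finite I" "B \<subseteq> lin_ops I" "id_op I \<in> op.span B"
    and adj: "\<And>A. A \<in> B \<Longrightarrow> adj_op A \<in> B"
  shows "nc_graph I (op.span B)"
proof -
  have "adj_op A \<in> op.span B" if "A \<in> op.span B" for A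
    using that
  proof (induction rule: op.span_induct_alt)
    case base
    show ?case by (simp only: adj_zero op.span_zero)
  next
    case (step c x y)
    then show ?case
      by (simp only: adj_add adj_scale op.span_add op.span_scale op.span_base adj)
  qed
  then have "adj_op ` op.span B = op.span B"
    by (metis adj_adj image_subset_iff subsetI subset_antisym image_eqI)
  then show ?thesis
    using assms op.span_minimal[OF assms(2) subspace_lin_ops]
    by (simp add: nc_graph_def op.subspace_span)
qed

lemma nc_graph_graph_space:
  fixes G :: "'x pair_pre_digraph"
  assumes "pair_graph G"
  shows "nc_graph (pverts G) (graph_space G)"
proof -
  interpret pair_graph G by fact
  have sym: "(y, x) \<in> parcs G" if "(x, y) \<in> parcs G" for x y
    using that pair_sym_arcs by (auto simp: symmetric_def sym_def)
  have id: "id_op (pverts G) = (\<Sum>x\<in>pverts G. ketbra x x)"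
  proof (intro ext)
    fix i j :: 'x
    have "(\<Sum>x\<in>A. ketbra x x) i j = (if i \<in> A \<and> i = j then 1 else 0)" if "finite A" for A :: "'x set"
      using that by (induction A) (auto simp: ketbra_def)
    then show "id_op (pverts G) i j = (\<Sum>x\<in>pverts G. ketbra x x) i j"
      by (simp add: id_op_def pair_finite_verts)
  qed
  show ?thesis
    unfolding graph_space_def
  proof (rule nc_graph_span)
    show "id_op (pverts G) \<in> op.span {ketbra x x' | x x'.
        x \<in> pverts G \<and> x' \<in> pverts G \<and> (x = x' \<or> (x, x') \<in> parcs G)}"
      unfolding id by (intro op.span_sum op.span_base) blast
  next
    fix A
    assume "A \<in> {ketbra x x' | x x'.
        x \<in> pverts G \<and> x' \<in> pverts G \<and> (x = x' \<or> (x, x') \<in> parcs G)}"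
    moreover have "adj_op (ketbra x y) = ketbra y x" for x y :: 'x
      by (auto simp: adj_op_def ketbra_def fun_eq_iff)
    ultimately show "adj_op A \<in> {ketbra x x' | x x'.
        x \<in> pverts G \<and> x' \<in> pverts G \<and> (x = x' \<or> (x, x') \<in> parcs G)}"
      using sym by fastforce
  qed (auto simp: pair_finite_verts lin_ops_def ketbra_def)
qed

lemma nc_graph_tensor_ops:
  assumes "nc_graph I S" "nc_graph J R"
  shows "nc_graph (I \<times> J) (tensor_ops S R)"
  unfolding tensor_ops_def
proof (rule nc_graph_span)
  have "id_op (I \<times> J) = kron (id_op I) (id_op J)"
    by (auto simp: id_op_def kron_def fun_eq_iff)
  then show "id_op (I \<times> J) \<in> op.span {kron A B | A B. A \<in> S \<and> B \<in> R}"
    using assms by (intro op.span_base) (auto simp: nc_graph_def)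
next
  fix A
  assume "A \<in> {kron A B | A B. A \<in> S \<and> B \<in> R}"
  moreover have "adj_op (kron A B) = kron (adj_op A) (adj_op B)" for A :: "'a op" and B :: "'b op"
    by (auto simp: adj_op_def kron_def fun_eq_iff)
  ultimately show "adj_op A \<in> {kron A B | A B. A \<in> S \<and> B \<in> R}"
    using assms unfolding nc_graph_def by blast
next
  have "A \<in> lin_ops I" if "A \<in> S" for A
    using that assms by (auto simp: nc_graph_def)
  moreover have "B \<in> lin_ops J" if "B \<in> R" for B
    using that assms by (auto simp: nc_graph_def)
  ultimately show "{kron A B | A B. A \<in> S \<and> B \<in> R} \<subseteq> lin_ops (I \<times> J)"
    by (fastforce simp: lin_ops_def kron_def)
qed (use assms in \<open>auto simp: nc_graph_def\<close>)

end

theory Submission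
  imports Defs
begin

text \<open>For a positive semidefinite \<open>M = 1 + T\<close> the norm is the supremum of \<open>\<langle>u|M|u\<rangle>\<close> over the unit
  ball, so by compactness \<open>\<theta>\<close> is attained at some pair \<open>(M, u)\<close>.  Tensoring with the identity
  carries such a pair from dimension \<open>n = 1\<close> to any \<open>n\<close>.  Conversely, a pair \<open>(M, v)\<close> in dimension
  \<open>n\<close> is compressed to one in dimension \<open>1\<close> with the same value, by replacing each block
  \<open>M\<^bsub>xy\<^esub>\<close> by its matrix element \<open>\<langle>w\<^sub>x|M\<^bsub>xy\<^esub>|w\<^sub>y\<rangle>\<close> between normalised blocks of \<open>v\<close>; vanishing blocks
  and identity diagonal blocks are respected.\<close>

section \<open>Inner products, norms and quadratic forms\<close>

lemma inner_vec_apply_op: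
  "inner_vec I v (apply_op I M w) = (\<Sum>i\<in>I. \<Sum>j\<in>I. cnj (v i) * M i j * w j)"
  by (simp add: inner_vec_def apply_op_def sum_distrib_left mult.assoc)

lemma norm_vec_nonneg [simp]: "0 \<le> norm_vec I v"
  by (simp add: norm_vec_def)

lemma norm_vec_zero [simp]: "norm_vec I (\<lambda>i. 0) = 0"
  by (simp add: norm_vec_def L2_set_0')

lemma norm_vec_square: "(norm_vec I v)\<^sup>2 = (\<Sum>i\<in>I. (cmod (v i))\<^sup>2)"
  by (simp add: norm_vec_def L2_set_def sum_nonneg)

lemma inner_vec_self: "inner_vec I v v = complex_of_real ((norm_vec I v)\<^sup>2)"
  unfolding norm_vec_square inner_vec_def of_real_sum
  by (intro sum.cong refl) (metis complex_norm_square mult.commute of_real_power)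

lemma norm_vec_scale: "norm_vec I (\<lambda>i. c * v i) = cmod c * norm_vec I v"
  by (simp add: norm_vec_def norm_mult L2_set_right_distrib)

lemma cmod_inner_vec_le: "cmod (inner_vec I v w) \<le> norm_vec I v * norm_vec I w"
proof -
  have "cmod (inner_vec I v w) \<le> (\<Sum>i\<in>I. cmod (cnj (v i) * w i))"
    unfolding inner_vec_def by (rule norm_sum)
  also have "\<dots> \<le> norm_vec I v * norm_vec I w"
    using L2_set_mult_ineq[of "\<lambda>i. cmod (v i)" "\<lambda>i. cmod (w i)" I]
    by (simp add: norm_vec_def norm_mult)
  finally show ?thesis .
qed

lemma cmod_le_norm_vec:
  assumes "finite I" "i \<in> I"
  shows "cmod (v i) \<le> norm_vec I v"
  unfolding norm_vec_def by (rule member_le_L2_set) (use assms in auto)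

definition unit_ball :: "'i set \<Rightarrow> 'i cvec set" where
  "unit_ball I = {v \<in> hilb I. norm_vec I v \<le> 1}"

lemma zero_in_unit_ball: "(\<lambda>i. 0) \<in> unit_ball I"
  by (simp add: unit_ball_def hilb_def)

text \<open>A real supremum dominates its members only when the set is bounded above. Coordinates of
  vectors in the unit ball have modulus at most 1, so the sum of the moduli of all entries of
  \<open>A\<close> is a bound.\<close>

lemma norm_apply_op_le_op_norm:
  assumes "finite I" "v \<in> unit_ball I"
  shows "norm_vec I (apply_op I A v) \<le> op_norm I A"
proof -
  have bound: "norm_vec I (apply_op I A u) \<le> (\<Sum>i\<in>I. \<Sum>j\<in>I. cmod (A i j))"
    if u: "u \<in> unit_ball I" for u
  proof -
    have "norm_vec I (apply_op I A u) \<le> (\<Sum>i\<in>I. cmod (apply_op I A u i))"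
      unfolding norm_vec_def by (rule L2_set_le_sum) simp
    also have "\<dots> \<le> (\<Sum>i\<in>I. \<Sum>j\<in>I. cmod (A i j))"
      unfolding apply_op_def
    proof (intro sum_mono order.trans[OF norm_sum])
      fix i j assume "j \<in> I"
      then have "cmod (u j) \<le> 1"
        using u cmod_le_norm_vec[OF assms(1), of j u] by (simp add: unit_ball_def)
      then show "cmod (A i j * u j) \<le> cmod (A i j)"
        by (simp add: norm_mult mult_left_le)
    qed
    finally show ?thesis .
  qed
  show ?thesis
    unfolding op_norm_def
  proof (rule cSUP_upper)
    show "v \<in> {v \<in> hilb I. norm_vec I v \<le> 1}"
      using assms by (simp add: unit_ball_def)
    show "bdd_above ((\<lambda>v. norm_vec I (apply_op I A v)) ` {v \<in> hilb I. norm_vec I v \<le> 1})"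
      using bound by (intro bdd_aboveI2) (auto simp: unit_ball_def)
  qed
qed

text \<open>Cauchy-Schwarz. Together with \<open>psd_op_norm_le\<close> this trades the operator
  norm of a positive semidefinite matrix for the supremum of its quadratic form.\<close>

lemma quadratic_form_le_op_norm:
  assumes "finite I" "u \<in> unit_ball I"
  shows "Re (inner_vec I u (apply_op I A u)) \<le> op_norm I A"
proof -
  have "Re (inner_vec I u (apply_op I A u)) \<le> norm_vec I u * norm_vec I (apply_op I A u)"
    by (rule order.trans[OF complex_Re_le_cmod cmod_inner_vec_le])
  also have "\<dots> \<le> norm_vec I (apply_op I A u)"
    using assms by (simp add: unit_ball_def mult_left_le_one_le)
  finally show ?thesis
    using norm_apply_op_le_op_norm[OF assms] by (rule order.trans)
qed

section \<open>Positive semidefinite matrices\<close>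

lemma psd_pairing:
  assumes "psd I M" "finite I" "i \<in> I" "j \<in> I" "i \<noteq> j"
  shows "0 \<le> M i i + z * M i j + cnj z * M j i + cnj z * z * M j j"
proof -
  define v where "v = (\<lambda>k. if k = i then 1 else if k = j then z else 0)"
  have sub: "{i, j} \<subseteq> I" using assms by auto
  have "v \<in> hilb I"
    using assms by (auto simp: hilb_def v_def)
  then have "0 \<le> inner_vec I v (apply_op I M v)"
    using assms(1) by (simp add: psd_def)
  also have "\<dots> = (\<Sum>a\<in>{i, j}. \<Sum>b\<in>{i, j}. cnj (v a) * M a b * v b)"
    unfolding inner_vec_apply_op
    using assms(2) sub
    by (intro sum.mono_neutral_cong_right ballI sum.neutral)
       (auto simp: v_def intro!: sum.mono_neutral_cong_right)
  also have "\<dots> = M i i + z * M i j + cnj z * M j i + cnj z * z * M j j"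
    using assms(5) by (auto simp: v_def algebra_simps)
  finally show ?thesis .
qed

lemma psd_diag:
  assumes "psd I M" "finite I" "i \<in> I"
  shows "0 \<le> M i i"
proof -
  define v where "v = (\<lambda>k. if k = i then (1::complex) else 0)"
  have "v \<in> hilb I"
    using assms by (auto simp: hilb_def v_def)
  then have "0 \<le> inner_vec I v (apply_op I M v)"
    using assms(1) by (simp add: psd_def)
  also have "\<dots> = (\<Sum>a\<in>{i}. \<Sum>b\<in>{i}. cnj (v a) * M a b * v b)"
    unfolding inner_vec_apply_op
    using assms(2,3)
    by (intro sum.mono_neutral_cong_right ballI sum.neutral)
       (auto simp: v_def intro!: sum.mono_neutral_cong_right)
  finally show ?thesis by (simp add: v_def)
qed

lemma psd_hermitian:
  assumes "psd I M" "finite I" "M \<in> lin_ops I"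
  shows "adj_op M = M"
proof -
  \<comment> \<open>Imaginary parts are compared, the diagonal being real: z = 1 makes
    \<open>M i j + M j i\<close> real, and z = \<i> makes \<open>M i j - M j i\<close> purely
    imaginary.\<close>
  have "cnj (M j i) = M i j" if "i \<in> I" "j \<in> I" "i \<noteq> j" for i j
    using psd_pairing[OF assms(1,2) that, of 1] psd_pairing[OF assms(1,2) that, of \<i>]
      psd_diag[OF assms(1,2) that(1)] psd_diag[OF assms(1,2) that(2)]
    by (simp add: less_eq_complex_def complex_eq_iff)
  moreover have "cnj (M i i) = M i i" if "i \<in> I" for i
    using psd_diag[OF assms(1,2) that] by (simp add: less_eq_complex_def complex_eq_iff)
  moreover have "M i j = 0" if "i \<notin> I \<or> j \<notin> I" for i j
    using that assms(3) by (auto simp: lin_ops_def)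
  ultimately show ?thesis
    unfolding adj_op_def fun_eq_iff by (metis complex_cnj_zero)
qed

lemma psd_entry_bound:
  assumes "psd I M" "finite I" "i \<in> I" "j \<in> I" "M i i = 1" "M j j = 1" "cnj (M j i) = M i j"
  shows "cmod (M i j) \<le> 1"
proof (cases "i = j \<or> M i j = 0")
  case False
  define z where "z = - cnj (sgn (M i j))"
  have zz: "cnj z * z = 1"
    using False complex_norm_square[of z] by (simp add: z_def norm_sgn mult.commute)
  have zM: "z * M i j = - of_real (cmod (M i j))"
  proof -
    have "cnj (sgn (M i j)) * M i j = of_real (cmod (M i j))"
      using False by (simp add: sgn_eq field_simps complex_norm_square[symmetric] power2_eq_square)
    then show ?thesis by (simp add: z_def)
  qed
  have "M j i = cnj (M i j)"
    using assms(7) by (metis complex_cnj_cnj)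
  then have zM': "cnj z * M j i = - of_real (cmod (M i j))"
    using arg_cong[OF zM, of cnj] by simp
  have "0 \<le> M i i + z * M i j + cnj z * M j i + cnj z * z * M j j"
    by (rule psd_pairing) (use assms False in auto)
  then show ?thesis
    unfolding zM zM' zz by (simp add: assms less_eq_complex_def)
qed (use assms in auto)

text \<open>No diagonalisation: with w = Mv and u = w/|w|, expanding 0 \<le> <u-v|M|u-v> gives 2|w|
  \<le> <u|M|u> + <v|M|v>, so u or v itself is a witness.\<close>

lemma psd_norm_apply_op_le:
  assumes M: "psd I M" "finite I" "M \<in> lin_ops I" and v: "v \<in> unit_ball I"
  shows "\<exists>u\<in>unit_ball I. norm_vec I (apply_op I M v) \<le> Re (inner_vec I u (apply_op I M u))"
proof -
  define w where "w = apply_op I M v"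
  have w: "w \<in> hilb I"
    using M(3) by (auto simp: w_def apply_op_def lin_ops_def hilb_def)
  have nonneg: "0 \<le> Re (inner_vec I u (apply_op I M u))" if "u \<in> hilb I" for u
    using M(1) that by (simp add: psd_def less_eq_complex_def)
  show ?thesis
  proof (cases "norm_vec I w = 0")
    case True
    then show ?thesis
      using v nonneg[of v] by (auto simp: w_def unit_ball_def)
  next
    case False
    define c where "c = complex_of_real (inverse (norm_vec I w))"
    define u where "u = (\<lambda>i. c * w i)"
    have u: "u \<in> unit_ball I"
      using w False by (simp add: u_def c_def unit_ball_def norm_vec_scale norm_inverse)
         (simp add: hilb_def)
    let ?q = "\<lambda>x y. inner_vec I x (apply_op I M y)"
    have "?q u v = c * inner_vec I w w"
      unfolding w_def[symmetric] by (simp add: u_def c_def inner_vec_def sum_distrib_left mult.assoc)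
    also have "\<dots> = norm_vec I w"
      using False by (simp add: c_def inner_vec_self power2_eq_square)
    finally have uv: "?q u v = norm_vec I w" .
    \<comment> \<open>Hermitian symmetry makes the two cross terms conjugate; one of them is real,
      so they coincide.\<close>
    have "?q v u = cnj (?q u v)"
    proof -
      have "cnj (M i j) = M j i" for i j
        using psd_hermitian[OF M] unfolding adj_op_def fun_eq_iff by simp
      then have "cnj (?q u v) = (\<Sum>i\<in>I. \<Sum>j\<in>I. cnj (v j) * M j i * u i)"
        by (simp add: inner_vec_apply_op mult_ac)
      then show ?thesis
        unfolding inner_vec_apply_op by (subst sum.swap) simp
    qed
    then have vu: "?q v u = norm_vec I w" by (simp add: uv)
    have "(\<lambda>i. u i - v i) \<in> hilb I"
      using u v by (simp add: unit_ball_def hilb_def)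
    then have "0 \<le> Re (?q (\<lambda>i. u i - v i) (\<lambda>i. u i - v i))" by (rule nonneg)
    also have "?q (\<lambda>i. u i - v i) (\<lambda>i. u i - v i) = ?q u u - ?q u v - ?q v u + ?q v v"
      by (simp add: inner_vec_apply_op algebra_simps sum.distrib sum_subtractf)
    finally have "2 * norm_vec I w \<le> Re (?q u u) + Re (?q v v)"
      by (simp add: uv vu)
    then have "norm_vec I w \<le> Re (?q u u) \<or> norm_vec I w \<le> Re (?q v v)" by linarith
    then show ?thesis using u v by (auto simp: w_def)
  qed
qed

lemma psd_op_norm_le:
  assumes "psd I M" "finite I" "M \<in> lin_ops I"
    and "\<And>u. u \<in> unit_ball I \<Longrightarrow> Re (inner_vec I u (apply_op I M u)) \<le> r"
  shows "op_norm I M \<le> r"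
  unfolding op_norm_def unit_ball_def[symmetric]
proof (rule cSUP_least)
  show "unit_ball I \<noteq> {}" using zero_in_unit_ball by blast
next
  fix v assume "v \<in> unit_ball I"
  then show "norm_vec I (apply_op I M v) \<le> r"
    using psd_norm_apply_op_le[OF assms(1-3)] assms(4) by (meson order.trans)
qed

section \<open>Operator spaces given by a zero pattern\<close>

text \<open>Graph spaces and their tensor products with full matrix algebras both have this form, so
  orthogonal complements and tensor products can be computed on relations.\<close>

definition supp_ops :: "('i \<times> 'i) set \<Rightarrow> 'i op set" where
  "supp_ops R = {T. \<forall>i j. (i, j) \<notin> R \<longrightarrow> T i j = 0}"

lemma subspace_supp_ops: "op.subspace (supp_ops R)"
  by (auto simp: op.subspace_def supp_ops_def scale_op_def)

lemma supp_ops_eq_sum: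
  assumes "finite R" "T \<in> supp_ops R"
  shows "T = (\<Sum>(x, y)\<in>R. scale_op (T x y) (ketbra x y))"
proof (intro ext)
  fix i j
  have sum_apply: "(\<Sum>p\<in>R. f p) i j = (\<Sum>p\<in>R. f p i j)" for f :: "_ \<Rightarrow> 'a op"
    using assms(1) by induction auto
  have "(\<Sum>(x, y)\<in>R. scale_op (T x y) (ketbra x y)) i j = (\<Sum>p\<in>R. if p = (i, j) then T i j else 0)"
    unfolding sum_apply by (intro sum.cong) (auto simp: scale_op_def ketbra_def split: if_splits)
  also have "\<dots> = T i j"
    using assms by (auto simp: supp_ops_def)
  finally show "T i j = (\<Sum>(x, y)\<in>R. scale_op (T x y) (ketbra x y)) i j" ..
qed

text \<open>The matrix units indexed by \<open>R\<close> span \<open>supp_ops R\<close>, so it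
  suffices that the generators include them and respect the pattern. This serves both the graph
  space and the tensor product.\<close>

lemma span_eq_supp_ops:
  assumes "finite R" "B \<subseteq> supp_ops R" "\<And>x y. (x, y) \<in> R \<Longrightarrow> ketbra x y \<in> B"
  shows "op.span B = supp_ops R"
proof
  show "op.span B \<subseteq> supp_ops R"
    by (rule op.span_minimal[OF assms(2) subspace_supp_ops])
  show "supp_ops R \<subseteq> op.span B"
  proof
    fix T assume "T \<in> supp_ops R"
    then have "T = (\<Sum>(x, y)\<in>R. scale_op (T x y) (ketbra x y))"
      by (rule supp_ops_eq_sum[OF assms(1)])
    moreover have "(\<Sum>(x, y)\<in>R. scale_op (T x y) (ketbra x y)) \<in> op.span B"
      using assms(3) by (intro op.span_sum) (auto intro: op.span_scale op.span_base)
    ultimately show "T \<in> op.span B" by simp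
  qed
qed

definition tensor_rel :: "('i \<times> 'i) set \<Rightarrow> 'j set \<Rightarrow> (('i \<times> 'j) \<times> ('i \<times> 'j)) set" where
  "tensor_rel R J = {((x, k), (y, l)) | x k y l. (x, y) \<in> R \<and> k \<in> J \<and> l \<in> J}"

lemma tensor_rel_iff [simp]:
  "((x, k), (y, l)) \<in> tensor_rel R J \<longleftrightarrow> (x, y) \<in> R \<and> k \<in> J \<and> l \<in> J"
  by (simp add: tensor_rel_def)

lemma tensor_ops_supp_ops:
  assumes "finite R" "finite J"
  shows "tensor_ops (supp_ops R) (lin_ops J) = supp_ops (tensor_rel R J)"
  unfolding tensor_ops_def
proof (rule span_eq_supp_ops)
  have "tensor_rel R J \<subseteq> (\<lambda>((x, y), (k, l)). ((x, k), (y, l))) ` (R \<times> (J \<times> J))"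
    by (force simp: tensor_rel_def)
  then show "finite (tensor_rel R J)"
    by (rule finite_subset) (use assms in auto)
next
  show "{kron A B |A B. A \<in> supp_ops R \<and> B \<in> lin_ops J} \<subseteq> supp_ops (tensor_rel R J)"
    by (fastforce simp: supp_ops_def lin_ops_def kron_def tensor_rel_def)
next
  fix p q :: "'a \<times> 'b"
  assume "(p, q) \<in> tensor_rel R J"
  then obtain x k y l where *: "p = (x, k)" "q = (y, l)" "(x, y) \<in> R" "k \<in> J" "l \<in> J"
    by (auto simp: tensor_rel_def)
  \<comment> \<open>A matrix unit of the product space factors into matrix units of the two tensor
    factors.\<close>
  have "ketbra p q = kron (ketbra x y) (ketbra k l)"
    by (auto simp: * ketbra_def kron_def fun_eq_iff)
  moreover have "ketbra x y \<in> supp_ops R" "ketbra k l \<in> lin_ops J"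
    using * by (auto simp: ketbra_def supp_ops_def lin_ops_def)
  ultimately show "ketbra p q \<in> {kron A B |A B. A \<in> supp_ops R \<and> B \<in> lin_ops J}"
    by blast
qed

text \<open>Pairing with the matrix unit |x><y| reads off the entry \<open>T x y\<close>.
  Conversely, in every term of the trace either the entry of \<open>X\<close> or that of
  \<open>T\<close> vanishes.\<close>

lemma hs_perp_supp_ops:
  assumes "finite I" "R \<subseteq> I \<times> I"
  shows "hs_perp I (supp_ops R) = {T \<in> lin_ops I. \<forall>(x, y)\<in>R. T x y = 0}"
proof -
  have tr: "trace_op I (comp_op I (adj_op X) T) = (\<Sum>i\<in>I. \<Sum>k\<in>I. cnj (X k i) * T k i)" for X T
    by (simp add: trace_op_def comp_op_def adj_op_def)
  have "T x y = 0" if T: "T \<in> hs_perp I (supp_ops R)" and xy: "(x, y) \<in> R" for T x y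
  proof -
    have "ketbra x y \<in> supp_ops R"
      using xy by (auto simp: supp_ops_def ketbra_def)
    then have "(\<Sum>i\<in>I. \<Sum>k\<in>I. cnj (ketbra x y k i) * T k i) = 0"
      using T unfolding hs_perp_def tr by blast
    also have "(\<Sum>i\<in>I. \<Sum>k\<in>I. cnj (ketbra x y k i) * T k i) =
        (\<Sum>i\<in>I. \<Sum>k\<in>I. if k = x then if i = y then T x y else 0 else 0)"
      by (intro sum.cong) (auto simp: ketbra_def)
    also have "\<dots> = T x y"
      using assms xy by auto
    finally show ?thesis .
  qed
  moreover have "trace_op I (comp_op I (adj_op X) T) = 0"
    if "X \<in> supp_ops R" "\<forall>(x, y)\<in>R. T x y = 0" for X T
    unfolding tr
  proof (intro sum.neutral ballI)
    fix i k
    show "cnj (X k i) * T k i = 0"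
      using that by (cases "(k, i) \<in> R") (auto simp: supp_ops_def)
  qed
  ultimately show ?thesis
    by (auto simp: hs_perp_def)
qed

section \<open>Theta as an optimisation over feasible matrices\<close>

text \<open>\<open>M\<close> stands for 1 + T: vanishing of T on \<open>R\<close> becomes agreement
  of \<open>M\<close> with the identity there.\<close>

definition feasible :: "'i set \<Rightarrow> ('i \<times> 'i) set \<Rightarrow> 'i op \<Rightarrow> bool" where
  "feasible I R M \<longleftrightarrow> M \<in> lin_ops I \<and> psd I M \<and> (\<forall>(x, y)\<in>R. M x y = (if x = y then 1 else 0))"

lemma feasible_entry:
  "feasible I R M \<Longrightarrow> (x, y) \<in> R \<Longrightarrow> M x y = (if x = y then 1 else 0)"
  by (auto simp: feasible_def)

lemma theta_supp_ops:
  assumes "finite I" "R \<subseteq> I \<times> I"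
  shows "theta I (supp_ops R) = (GREATEST r. \<exists>M. feasible I R M \<and> r = op_norm I M)"
proof -
  have "(\<exists>T. T \<in> hs_perp I (supp_ops R) \<and> psd I (id_op I + T) \<and> r = op_norm I (id_op I + T)) \<longleftrightarrow>
      (\<exists>M. feasible I R M \<and> r = op_norm I M)" (is "?L \<longleftrightarrow> ?R") for r
  proof
    assume ?L
    then obtain T where "T \<in> hs_perp I (supp_ops R)" "psd I (id_op I + T)" "r = op_norm I (id_op I + T)"
      by blast
    then show ?R
      using assms(2) unfolding hs_perp_supp_ops[OF assms]
      by (intro exI[of _ "id_op I + T"]) (auto simp: feasible_def lin_ops_def id_op_def)
  next
    assume ?R
    then obtain M where M: "feasible I R M" "r = op_norm I M" by blast
    have "id_op I + (M - id_op I) = M" by simp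
    moreover have "M - id_op I \<in> hs_perp I (supp_ops R)"
      using M(1) assms(2) unfolding hs_perp_supp_ops[OF assms]
      by (auto simp: feasible_def lin_ops_def id_op_def)
    ultimately show ?L
      using M unfolding feasible_def by (metis)
  qed
  then show ?thesis
    unfolding theta_def by presburger
qed

text \<open>One pair (M, u) reaching r bounds the norm of M from below, and the bound on all pairs
  limits every feasible norm from above. Hence r is attained, as \<open>Greatest\<close>
  requires.\<close>

lemma theta_eqI:
  assumes "finite I" "R \<subseteq> I \<times> I"
    and "feasible I R M" "u \<in> unit_ball I" "r \<le> Re (inner_vec I u (apply_op I M u))"
    and le: "\<And>M u. feasible I R M \<Longrightarrow> u \<in> unit_ball I \<Longrightarrow> Re (inner_vec I u (apply_op I M u)) \<le> r"
  shows "theta I (supp_ops R) = r"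
  unfolding theta_supp_ops[OF assms(1,2)]
proof (rule Greatest_equality)
  have upper: "op_norm I N \<le> r" if "feasible I R N" for N
    using that le by (intro psd_op_norm_le assms(1)) (auto simp: feasible_def)
  then show "y \<le> r" if "\<exists>M. feasible I R M \<and> y = op_norm I M" for y
    using that by blast
  have "r \<le> op_norm I M"
    using quadratic_form_le_op_norm[OF assms(1,4), of M] assms(5) by linarith
  then show "\<exists>M. feasible I R M \<and> r = op_norm I M"
    using upper assms(3) by (intro exI[of _ M]) (auto intro: antisym)
qed

lemma psd_id_op:
  assumes "finite I"
  shows "psd I (id_op I)"
  unfolding psd_def
proof
  fix v
  have "inner_vec I v (apply_op I (id_op I) v) = inner_vec I v v"
    unfolding inner_vec_def
  proof (intro sum.cong refl)
    fix i assume "i \<in> I"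
    then have "apply_op I (id_op I) v i = (\<Sum>j\<in>I. if j = i then v i else 0)"
      unfolding apply_op_def by (intro sum.cong) (auto simp: id_op_def)
    then show "cnj (v i) * apply_op I (id_op I) v i = cnj (v i) * v i"
      using assms \<open>i \<in> I\<close> by simp
  qed
  then show "0 \<le> inner_vec I v (apply_op I (id_op I) v)"
    by (simp add: inner_vec_self less_eq_complex_def)
qed

lemma feasible_id_op:
  assumes "finite I" "R \<subseteq> I \<times> I"
  shows "feasible I R (id_op I)"
  using assms psd_id_op[OF assms(1)] by (auto simp: feasible_def lin_ops_def id_op_def)

section \<open>Compactness and existence of an optimum\<close>

text \<open>Tychonoff's theorem. Vectors and matrices are functions on the whole index type,
  possibly infinite, with the product topology.\<close>

lemma compact_PiE_UNIV:
  fixes K :: "'i \<Rightarrow> 'a::topological_space set"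
  assumes "\<And>i. compact (K i)"
  shows "compact (PiE UNIV K)"
proof -
  have "compactin (product_topology (\<lambda>i. euclidean) UNIV) (PiE UNIV K)"
    unfolding compactin_PiE using assms by simp
  then show ?thesis
    by (simp add: euclidean_product_topology)
qed

lemma continuous_on_coordinate:
  "continuous_on A (\<lambda>x :: 'i \<Rightarrow> 'b::topological_space. x i)"
  using continuous_on_id[of A] by (rule continuous_on_product_then_coordinatewise)

lemma continuous_on_entry:
  "continuous_on A (\<lambda>M :: 'i \<Rightarrow> 'j \<Rightarrow> 'b::topological_space. M i j)"
  using continuous_on_coordinate[of A i] by (rule continuous_on_product_then_coordinatewise)

lemma continuous_on_quadratic_form:
  "continuous_on A (\<lambda>p. inner_vec I (snd p) (apply_op I (fst p) (snd p)))"
proof -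
  have "continuous_on A (\<lambda>p :: 'a op \<times> 'a cvec. fst p i j)" for i j
    by (rule continuous_on_compose2[OF continuous_on_entry continuous_on_fst[OF continuous_on_id] subset_UNIV])
  moreover have "continuous_on A (\<lambda>p :: 'a op \<times> 'a cvec. snd p i)" for i
    by (rule continuous_on_compose2[OF continuous_on_coordinate continuous_on_snd[OF continuous_on_id] subset_UNIV])
  ultimately show ?thesis
    unfolding inner_vec_apply_op by (intro continuous_intros)
qed

text \<open>The extreme value theorem, jointly in M and u. Since \<open>R\<close> contains the
  diagonal, feasible matrices have unit diagonal, and \<open>psd_entry_bound\<close> then bounds all
  their entries by 1.\<close>

lemma exists_optimum:
  assumes I: "finite I" "R \<subseteq> I \<times> I" "Id_on I \<subseteq> R"
  shows "\<exists>M u. feasible I R M \<and> u \<in> unit_ball I \<and>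
    (\<forall>M' u'. feasible I R M' \<longrightarrow> u' \<in> unit_ball I \<longrightarrow>
      Re (inner_vec I u' (apply_op I M' u')) \<le> Re (inner_vec I u (apply_op I M u)))"
proof -
  \<comment> \<open>Outside \<open>I\<close> the radius is 0, which confines those coordinates to
    the single value 0.\<close>
  define KM :: "'a op set" where
    "KM = PiE UNIV (\<lambda>i. PiE UNIV (\<lambda>j. cball 0 (if i \<in> I \<and> j \<in> I then 1 else 0)))"
  define KV :: "'a cvec set" where "KV = PiE UNIV (\<lambda>i. cball 0 (if i \<in> I then 1 else 0))"
  have compact: "compact KM" "compact KV"
    unfolding KM_def KV_def by (intro compact_PiE_UNIV compact_cball)+
  have "feasible I R M \<Longrightarrow> M \<in> KM" for M
  proof -
    assume M: "feasible I R M"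
    have "cmod (M i j) \<le> (if i \<in> I \<and> j \<in> I then 1 else 0)" for i j
    proof (cases "i \<in> I \<and> j \<in> I")
      case True
      have "(i, i) \<in> R" "(j, j) \<in> R"
        using I(3) True by auto
      then have "M i i = 1" "M j j = 1"
        using M by (auto simp: feasible_def)
      moreover have "cnj (M j i) = M i j"
        using psd_hermitian[of I M] M I(1) unfolding feasible_def adj_op_def fun_eq_iff by blast
      ultimately show ?thesis
        using psd_entry_bound[of I M i j] M I(1) True by (simp add: feasible_def)
    next
      case False
      then show ?thesis using M by (auto simp: feasible_def lin_ops_def)
    qed
    then show "M \<in> KM" by (simp add: KM_def PiE_iff)
  qed
  then have feas: "{M. feasible I R M} = KM \<inter> {M. feasible I R M}" by blast
  have closed_feas: "closed {M. feasible I R M}"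
  proof -
    \<comment> \<open>Each entry and each test vector contributes one closed condition; the complex
      order splits into a real inequality and an imaginary equation.\<close>
    have eq: "{M. feasible I R M} = (\<Inter>i. \<Inter>j. {M. i \<notin> I \<or> j \<notin> I \<longrightarrow> M i j = 0}) \<inter>
       (\<Inter>v\<in>hilb I. {M. 0 \<le> Re (inner_vec I v (apply_op I M v))} \<inter>
          {M. Im (inner_vec I v (apply_op I M v)) = 0}) \<inter>
       (\<Inter>p\<in>R. {M. M (fst p) (snd p) = (if fst p = snd p then 1 else 0)})"
      by (simp only: set_eq_iff mem_Collect_eq Int_iff INT_iff feasible_def lin_ops_def psd_def
          less_eq_complex_def case_prod_beta) auto
    have supp: "closed {M :: 'a op. i \<notin> I \<or> j \<notin> I \<longrightarrow> M i j = 0}" for i j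
      by (cases "i \<notin> I \<or> j \<notin> I")
        (simp_all add: closed_Collect_eq continuous_on_entry)
    have quad: "continuous_on UNIV (\<lambda>M. inner_vec I v (apply_op I M v))" for v
      unfolding inner_vec_apply_op by (intro continuous_intros continuous_on_entry)
    show ?thesis
      unfolding eq
      by (intro closed_Int closed_INT ballI supp closed_Collect_le closed_Collect_eq
          continuous_on_const continuous_on_Re continuous_on_Im quad continuous_on_entry)
  qed
  have comp_feas: "compact {M. feasible I R M}"
    using compact_Int_closed[OF compact(1) closed_feas] feas by argo
  have "u \<in> KV" if u: "u \<in> unit_ball I" for u
  proof -
    have "cmod (u i) \<le> (if i \<in> I then 1 else 0)" for i
      using u cmod_le_norm_vec[OF I(1), of i u] by (cases "i \<in> I") (auto simp: unit_ball_def hilb_def)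
    then show ?thesis by (simp add: KV_def PiE_iff)
  qed
  then have ball: "unit_ball I = KV \<inter> unit_ball I" by blast
  have closed_ball: "closed (unit_ball I)"
  proof -
    have eq: "unit_ball I = (\<Inter>i. {v. i \<notin> I \<longrightarrow> v i = 0}) \<inter> {v. norm_vec I v \<le> 1}"
      by (auto simp: unit_ball_def hilb_def)
    have supp: "closed {v :: 'a cvec. i \<notin> I \<longrightarrow> v i = 0}" for i
      by (cases "i \<in> I") (simp_all add: closed_Collect_eq continuous_on_coordinate)
    have "continuous_on UNIV (norm_vec I)"
      unfolding norm_vec_def[abs_def] L2_set_def by (intro continuous_intros continuous_on_coordinate)
    then show ?thesis
      unfolding eq by (intro closed_Int closed_INT ballI supp closed_Collect_le continuous_on_const)
  qed
  have comp_ball: "compact (unit_ball I)"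
    using compact_Int_closed[OF compact(2) closed_ball] ball by argo
  let ?f = "\<lambda>p. Re (inner_vec I (snd p) (apply_op I (fst p) (snd p)))"
  have "continuous_on ({M. feasible I R M} \<times> unit_ball I) ?f"
    by (intro continuous_on_Re continuous_on_quadratic_form)
  moreover have "{M. feasible I R M} \<times> unit_ball I \<noteq> {}"
    using feasible_id_op[OF I(1,2)] zero_in_unit_ball by blast
  ultimately obtain p where "p \<in> {M. feasible I R M} \<times> unit_ball I"
    "\<forall>q\<in>{M. feasible I R M} \<times> unit_ball I. ?f q \<le> ?f p"
    using continuous_attains_sup[OF compact_Times[OF comp_feas comp_ball]] by blast
  then show ?thesis
    by (intro exI[of _ "fst p"] exI[of _ "snd p"]) auto
qed

section \<open>Passing between the two dimensions\<close>

text \<open>The quadratic form of M tensor 1 at v is the sum over k of the forms of M at the slices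
  v(-, k), so positivity is inherited slice by slice.\<close>

lemma feasible_kron_id:
  fixes I :: "'i set" and J :: "'j set"
  assumes "finite J" "feasible I R M"
  shows "feasible (I \<times> J) (tensor_rel R J) (kron M (id_op J))"
proof -
  have "psd (I \<times> J) (kron M (id_op J))"
    unfolding psd_def
  proof
    fix v :: "('i \<times> 'j) cvec"
    assume v: "v \<in> hilb (I \<times> J)"
    have "inner_vec (I \<times> J) v (apply_op (I \<times> J) (kron M (id_op J)) v) =
        (\<Sum>i\<in>I. \<Sum>k\<in>J. \<Sum>j\<in>I. cnj (v (i, k)) * M i j * v (j, k))"
      unfolding inner_vec_apply_op sum.cartesian_product'
    proof (intro sum.cong refl)
      fix i k j assume "k \<in> J"
      have "(\<Sum>l\<in>J. cnj (v (i, k)) * kron M (id_op J) (i, k) (j, l) * v (j, l)) =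
          (\<Sum>l\<in>J. if l = k then cnj (v (i, k)) * M i j * v (j, k) else 0)"
        using \<open>k \<in> J\<close> by (intro sum.cong) (auto simp: kron_def id_op_def)
      then show "(\<Sum>l\<in>J. cnj (v (i, k)) * kron M (id_op J) (i, k) (j, l) * v (j, l)) =
          cnj (v (i, k)) * M i j * v (j, k)"
        using assms(1) \<open>k \<in> J\<close> by simp
    qed
    also have "\<dots> = (\<Sum>k\<in>J. inner_vec I (\<lambda>i. v (i, k)) (apply_op I M (\<lambda>i. v (i, k))))"
      unfolding inner_vec_apply_op by (rule sum.swap)
    also have "\<dots> \<ge> 0"
      using assms(2) v by (intro sum_nonneg) (auto simp: feasible_def psd_def hilb_def)
    finally show "0 \<le> inner_vec (I \<times> J) v (apply_op (I \<times> J) (kron M (id_op J)) v)" .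
  qed
  then show ?thesis
    using assms(2) by (auto simp: feasible_def lin_ops_def kron_def id_op_def tensor_rel_def)
qed

text \<open>The witness is the compression \<open>W\<^sup>* M W\<close> by the isometry \<open>W |x\<rangle> = |x\<rangle> \<otimes> |w\<^sub>x\<rangle>\<close>, where
  \<open>w\<^sub>x\<close> is the normalised \<open>x\<close>-block of \<open>v\<close>, so that \<open>v = W p\<close> for the vector \<open>p\<close> of block norms.\<close>

lemma feasible_compression:
  assumes fin: "finite I" "finite J" "J \<noteq> {}" and R: "R \<subseteq> I \<times> I" "Id_on I \<subseteq> R"
    and M: "feasible (I \<times> J) (tensor_rel R J) M" and v: "v \<in> unit_ball (I \<times> J)"
  shows "\<exists>N p. feasible I R N \<and> p \<in> unit_ball I \<and>
    inner_vec I p (apply_op I N p) = inner_vec (I \<times> J) v (apply_op (I \<times> J) M v)"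
proof -
  obtain k0 where k0: "k0 \<in> J" using fin by blast
  define n where "n x = norm_vec J (\<lambda>k. v (x, k))" for x
  define p where "p x = complex_of_real (n x)" for x
  \<comment> \<open>A zero block cannot be normalised; the basis vector at \<open>k0\<close>
    replaces it, so that every \<open>w x\<close> is a unit vector and N keeps unit
    diagonal.\<close>
  define w where "w x k = (if n x = 0 then if k = k0 then 1 else 0 else v (x, k) / p x)" for x k
  define N where "N x y = (\<Sum>k\<in>J. \<Sum>l\<in>J. cnj (w x k) * M (x, k) (y, l) * w y l)" for x y
  have w_unit: "(\<Sum>k\<in>J. cnj (w x k) * w x k) = 1" for x
  proof (cases "n x = 0")
    case True
    then have "(\<Sum>k\<in>J. cnj (w x k) * w x k) = (\<Sum>k\<in>J. if k = k0 then 1 else 0)"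
      by (intro sum.cong) (auto simp: w_def)
    then show ?thesis using fin(2) k0 by simp
  next
    case False
    have "norm_vec J (w x) = norm_vec J (\<lambda>k. inverse (p x) * v (x, k))"
      using False by (simp add: w_def[abs_def] field_simps)
    also have "\<dots> = 1"
      using False unfolding norm_vec_scale n_def[symmetric]
      by (simp add: p_def norm_inverse) (simp add: n_def)
    finally show ?thesis
      using inner_vec_self[of J "w x"] by (simp add: inner_vec_def)
  qed
  have vpw: "v (x, k) = p x * w x k" if "k \<in> J" for x k
  proof (cases "n x = 0")
    case True
    then have "cmod (v (x, k)) \<le> 0"
      using cmod_le_norm_vec[OF fin(2) that, of "\<lambda>k. v (x, k)"] by (simp add: n_def)
    then show ?thesis using True by (simp add: p_def)
  qed (simp add: w_def p_def)
  \<comment> \<open>Here \<open>u\<close> = Wq on the coordinates in \<open>J\<close>. For arbitrary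
    q this yields positivity of N, and for q = p, u = v it yields equality of the values.\<close>
  have quad: "inner_vec I q (apply_op I N q) =
      inner_vec (I \<times> J) u (apply_op (I \<times> J) M u)"
    if u: "\<And>x k. k \<in> J \<Longrightarrow> u (x, k) = q x * w x k" for q u
  proof -
    have "inner_vec (I \<times> J) u (apply_op (I \<times> J) M u) =
        (\<Sum>x\<in>I. \<Sum>k\<in>J. \<Sum>y\<in>I. \<Sum>l\<in>J. cnj (q x * w x k) * M (x, k) (y, l) * (q y * w y l))"
      unfolding inner_vec_apply_op sum.cartesian_product'
      by (intro sum.cong) (auto simp: u)
    also have "\<dots> = (\<Sum>x\<in>I. \<Sum>y\<in>I. \<Sum>k\<in>J. \<Sum>l\<in>J. cnj (q x * w x k) * M (x, k) (y, l) * (q y * w y l))"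
      by (intro sum.cong refl sum.swap)
    also have "\<dots> = inner_vec I q (apply_op I N q)"
      unfolding inner_vec_apply_op N_def
      by (simp add: sum_distrib_left sum_distrib_right mult_ac)
    finally show ?thesis ..
  qed
  have "feasible I R N"
    unfolding feasible_def
  proof (intro conjI ballI)
    have "M (x, k) (y, l) = 0" if "x \<notin> I \<or> y \<notin> I" for x y k l
      using M that by (auto simp: feasible_def lin_ops_def)
    then show "N \<in> lin_ops I"
      by (simp add: lin_ops_def N_def)
    show "psd I N"
      unfolding psd_def
    proof
      fix q assume "q \<in> hilb I"
      define u where "u = (\<lambda>(x, k). if k \<in> J then q x * w x k else 0)"
      have "u \<in> hilb (I \<times> J)"
        using \<open>q \<in> hilb I\<close> by (auto simp: hilb_def u_def)
      then show "0 \<le> inner_vec I q (apply_op I N q)"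
        using M by (subst quad[of u]) (auto simp: u_def feasible_def psd_def)
    qed
    fix xy assume "xy \<in> R"
    then obtain x y where xy: "xy = (x, y)" "(x, y) \<in> R" by (cases xy) auto
    \<comment> \<open>Over a pair in \<open>R\<close> the block of M is the identity or zero, so N
      has the entry <\<open>w x\<close>|\<open>w x\<close>> = 1 or 0 there.\<close>
    have "M (x, k) (y, l) = (if x = y \<and> k = l then 1 else 0)" if "k \<in> J" "l \<in> J" for k l
    proof -
      have "((x, k), (y, l)) \<in> tensor_rel R J" using xy(2) that by simp
      then show ?thesis using feasible_entry[OF M] by auto
    qed
    then have "N x y = (\<Sum>k\<in>J. \<Sum>l\<in>J. if x = y \<and> k = l then cnj (w x k) * w x k else 0)"
      unfolding N_def by (intro sum.cong) auto
    also have "\<dots> = (if x = y then 1 else 0)"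
      using fin(2) w_unit by simp
    finally show "case xy of (x, y) \<Rightarrow> N x y = (if x = y then 1 else 0)"
      by (simp add: xy)
  qed
  moreover have "p \<in> unit_ball I"
  proof -
    have "p x = 0" if "x \<notin> I" for x
      using v that by (simp add: p_def n_def unit_ball_def hilb_def)
    \<comment> \<open>Pythagoras over the blocks of v, whose norms are the entries of p.\<close>
    moreover have "(norm_vec I p)\<^sup>2 = (norm_vec (I \<times> J) v)\<^sup>2"
      unfolding norm_vec_square sum.cartesian_product'
      by (simp add: p_def n_def norm_vec_square)
    then have "norm_vec I p = norm_vec (I \<times> J) v"
      by (simp add: power2_eq_iff_nonneg)
    ultimately show ?thesis
      using v by (simp add: unit_ball_def hilb_def)
  qed
  ultimately show ?thesis
    using quad[of v p] vpw by blast
qed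

text \<open>Compactness is invoked over \<open>I\<close> only: the optimal pair found there lifts to
  a pair with the same value, and compression shows that no pair over the product exceeds
  it.\<close>

lemma theta_tensor_lin_ops:
  assumes fin: "finite I" "finite J" "J \<noteq> {}" and R: "R \<subseteq> I \<times> I" "Id_on I \<subseteq> R"
  shows "theta (I \<times> J) (tensor_ops (supp_ops R) (lin_ops J)) = theta I (supp_ops R)"
proof -
  obtain M u where opt: "feasible I R M" "u \<in> unit_ball I"
    "\<And>M' u'. feasible I R M' \<Longrightarrow> u' \<in> unit_ball I \<Longrightarrow>
      Re (inner_vec I u' (apply_op I M' u')) \<le> Re (inner_vec I u (apply_op I M u))"
    using exists_optimum[OF fin(1) R] by blast
  define r where "r = Re (inner_vec I u (apply_op I M u))"
  obtain k0 where k0: "k0 \<in> J" using fin by blast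
  define v where "v = (\<lambda>(x, k). if k = k0 then u x else 0)"
  have "theta I (supp_ops R) = r"
    by (rule theta_eqI[OF fin(1) R(1) opt(1,2)]) (use opt(3) in \<open>auto simp: r_def\<close>)
  moreover have "theta (I \<times> J) (supp_ops (tensor_rel R J)) = r"
  proof (rule theta_eqI)
    have "(norm_vec (I \<times> J) v)\<^sup>2 = (norm_vec I u)\<^sup>2"
      unfolding norm_vec_square sum.cartesian_product'
      using fin(2) k0 by (simp add: v_def if_distrib[of "\<lambda>z. (cmod z)\<^sup>2"] cong: if_cong)
    then have "norm_vec (I \<times> J) v = norm_vec I u"
      by (simp add: power2_eq_iff_nonneg)
    then show "v \<in> unit_ball (I \<times> J)"
      using opt(2) k0 by (auto simp: unit_ball_def hilb_def v_def)
    have "inner_vec (I \<times> J) v (apply_op (I \<times> J) (kron M (id_op J)) v) =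
        (\<Sum>x\<in>I. \<Sum>k\<in>J. \<Sum>y\<in>I. \<Sum>l\<in>J. if l = k then if k = k0 then cnj (u x) * M x y * u y else 0 else 0)"
      unfolding inner_vec_apply_op sum.cartesian_product'
      by (intro sum.cong) (auto simp: kron_def id_op_def v_def)
    also have "\<dots> = (\<Sum>x\<in>I. \<Sum>y\<in>I. \<Sum>k\<in>J. if k = k0 then cnj (u x) * M x y * u y else 0)"
      using fin(2) by (intro sum.cong refl) (subst sum.swap, simp)
    also have "\<dots> = inner_vec I u (apply_op I M u)"
      using fin(2) k0 by (simp add: inner_vec_apply_op)
    finally show "r \<le> Re (inner_vec (I \<times> J) v (apply_op (I \<times> J) (kron M (id_op J)) v))"
      by (simp add: r_def)
    show "feasible (I \<times> J) (tensor_rel R J) (kron M (id_op J))"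
      by (rule feasible_kron_id[OF fin(2) opt(1)])
    show "Re (inner_vec (I \<times> J) v' (apply_op (I \<times> J) M' v')) \<le> r"
      if "feasible (I \<times> J) (tensor_rel R J) M'" "v' \<in> unit_ball (I \<times> J)" for M' v'
      using feasible_compression[OF fin R that] opt(3) unfolding r_def by metis
  qed (use fin R in \<open>auto simp: tensor_rel_def\<close>)
  moreover have "finite R"
    using R(1) by (rule finite_subset) (simp add: fin(1))
  ultimately show ?thesis
    by (simp add: tensor_ops_supp_ops fin(2))
qed

section \<open>Graph spaces and the Lovasz number\<close>

definition graph_rel :: "'x pair_pre_digraph \<Rightarrow> ('x \<times> 'x) set" where
  "graph_rel G = {(x, y) \<in> pverts G \<times> pverts G. x = y \<or> (x, y) \<in> parcs G}"

lemma graph_space_eq_supp_ops: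
  assumes "finite (pverts G)"
  shows "graph_space G = supp_ops (graph_rel G)"
  unfolding graph_space_def
proof (rule span_eq_supp_ops)
  show "finite (graph_rel G)"
    by (rule finite_subset[of _ "pverts G \<times> pverts G"]) (use assms in \<open>auto simp: graph_rel_def\<close>)
qed (auto simp: graph_rel_def supp_ops_def ketbra_def)

text \<open>Both maxima range over the same T: orthogonality to the graph space is the zero pattern
  of the Lovasz number, and positivity of 1 + T forces T to be Hermitian by
  \<open>psd_hermitian\<close>.\<close>

lemma theta_graph_space_eq_lovasz_number:
  assumes "finite (pverts G)"
  shows "theta (pverts G) (graph_space G) = lovasz_number G"
proof -
  let ?I = "pverts G"
  have sub: "graph_rel G \<subseteq> ?I \<times> ?I" by (auto simp: graph_rel_def)
  have "T \<in> hs_perp ?I (graph_space G) \<and> psd ?I (id_op ?I + T) \<longleftrightarrow>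
    T \<in> lin_ops ?I \<and> adj_op T = T \<and>
    (\<forall>x\<in>?I. \<forall>y\<in>?I. x = y \<or> (x, y) \<in> parcs G \<longrightarrow> T x y = 0) \<and> psd ?I (id_op ?I + T)" for T
  proof -
    have "adj_op T = T" if "T \<in> lin_ops ?I" "psd ?I (id_op ?I + T)"
    proof -
      have "id_op ?I + T \<in> lin_ops ?I"
        using that(1) by (auto simp: lin_ops_def id_op_def)
      then have "adj_op (id_op ?I + T) = id_op ?I + T"
        using psd_hermitian[OF that(2) assms] by blast
      moreover have "adj_op (id_op ?I) = id_op ?I"
        by (auto simp: adj_op_def id_op_def fun_eq_iff)
      ultimately show ?thesis by (simp add: adj_add)
    qed
    then show ?thesis
      unfolding graph_space_eq_supp_ops[OF assms] hs_perp_supp_ops[OF assms sub]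
      by (auto simp: graph_rel_def)
  qed
  then show ?thesis
    unfolding theta_def lovasz_number_def Bex_def by (intro arg_cong[of _ _ Greatest] ext) blast
qed

theorem mainTheorem5:
  fixes G :: "'x pair_pre_digraph"
  assumes "pair_graph G"
  shows "quantum_theta (pverts G) (graph_space G) = ereal (theta (pverts G) (graph_space G)) \<and>
    theta (pverts G) (graph_space G) = lovasz_number G"
proof -
  interpret pair_graph G by fact
  have "theta (pverts G \<times> {..<n}) (tensor_ops (graph_space G) (lin_ops {..<n})) =
      theta (pverts G) (graph_space G)" if "n \<in> {1..}" for n :: nat
    unfolding graph_space_eq_supp_ops[OF pair_finite_verts]
    \<comment> \<open>From n \<ge> 1 the auxiliary index set is nonempty, which supplies the index
      \<open>k0\<close> of the compression. The supremum is then over a constant family.\<close>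
    by (rule theta_tensor_lin_ops) (use that in \<open>auto simp: pair_finite_verts graph_rel_def lessThan_empty_iff\<close>)
  then have "quantum_theta (pverts G) (graph_space G) =
      (SUP n\<in>{1::nat..}. ereal (theta (pverts G) (graph_space G)))"
    unfolding quantum_theta_def by (intro SUP_cong) auto
  then show ?thesis
    using theta_graph_space_eq_lovasz_number[OF pair_finite_verts] by simp
qed

end
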